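(* Let $E$ be a separable Banach space which is an absolute Lipschitz retract and contains an isomorphic copy of $c_0$. If a metric space $M$ contains a bilipschitz copy of the unit sphere $S_E$ of $E$, then the space $\mathrm{Lip}_0(M)$ is not a Grothendieck space.
   Context: All vector spaces are real. A Banach space $X$ is a Grothendieck space if every weak* convergent sequence in $X^*$ converges weakly. For a metric space $(M,\rho)$ with a distinguished base point $e$, $\mathrm{Lip}_0(M)$ is the Banach space of all Lipschitz functions $f\colon M\to\mathbb{R}$ with $f(e)=0$, with norm $\|f\|=\mathrm{Lip}(f)=\sup_{x\neq y}|f(x)-f(y)|/\rho(x,y)$. A metric space is an absolute Lipschitz retract if it is a Lipschitz retract of every metric space containing it; equivalently, a metric space $Q$ is an absolute Lipschitz retract if for all metric spaces $P\subseteq N$ every Lipschitz mapping $P\to Q$ has a Lipschitz extension $N\to Q$. $S_E=\{x\in E\colon\|x\|=1\}$ carries the metric induced by the norm. *)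

theory Defs
  imports "HOL-Analysis.Analysis"
begin

definition weak_star_limit ::
    "(nat \<Rightarrow> 'x::real_normed_vector \<Rightarrow>\<^sub>L real) \<Rightarrow> ('x \<Rightarrow>\<^sub>L real) \<Rightarrow> bool" where
  "weak_star_limit \<phi> \<psi> \<longleftrightarrow>
     (\<forall>x. (\<lambda>n. blinfun_apply (\<phi> n) x) \<longlonglongrightarrow> blinfun_apply \<psi> x)"

definition weak_limit :: "(nat \<Rightarrow> 'x::real_normed_vector) \<Rightarrow> 'x \<Rightarrow> bool" where
  "weak_limit u l \<longleftrightarrow>
     (\<forall>\<Phi> :: 'x \<Rightarrow>\<^sub>L real. (\<lambda>n. blinfun_apply \<Phi> (u n)) \<longlonglongrightarrow> blinfun_apply \<Phi> l)"

definition grothendieck_space :: "'x::banach itself \<Rightarrow> bool" where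
  "grothendieck_space _ \<longleftrightarrow>
     (\<forall>\<phi> :: nat \<Rightarrow> 'x \<Rightarrow>\<^sub>L real.
        (\<exists>\<psi>. weak_star_limit \<phi> \<psi>) \<longrightarrow> (\<exists>\<psi>. weak_limit \<phi> \<psi>))"

text \<open>The type class stands for an arbitrary nonempty metric space with an arbitrarily chosen base
  point: there is no axiom on \<open>base_point\<close>.\<close>

class pointed_metric_space = metric_space +
  fixes base_point :: 'a

typedef (overloaded) 'm lip0 =
  "{f :: 'm::pointed_metric_space \<Rightarrow> real.
      f base_point = 0 \<and> (\<exists>C. C-lipschitz_on UNIV f)}"
  morphisms lip0_apply Lip0
  by (rule exI[of _ "\<lambda>_. 0"]) (auto simp: lipschitz_on_def intro: exI[of _ 0])

setup_lifting type_definition_lip0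

text \<open>Pairs \<open>x = y\<close> contribute \<open>0 / 0 = 0\<close> to the supremum, so they do not change it, and
  they give the value \<open>0\<close> when the space is a single point.\<close>

definition lip_const :: "('m::metric_space \<Rightarrow> real) \<Rightarrow> real" where
  "lip_const f = (SUP (x, y) \<in> UNIV. \<bar>f x - f y\<bar> / dist x y)"

lemma lip_const_le:
  assumes "C-lipschitz_on UNIV f"
  shows "lip_const f \<le> C"
  unfolding lip_const_def
proof (rule cSUP_least)
  show "(UNIV :: ('a \<times> 'a) set) \<noteq> {}" by simp
  fix p :: "'a \<times> 'a"
  obtain x y where p: "p = (x, y)" by (cases p)
  show "(case p of (x, y) \<Rightarrow> \<bar>f x - f y\<bar> / dist x y) \<le> C"
    using lipschitz_onD[OF assms, of x y] lipschitz_on_nonneg[OF assms]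
    by (cases "x = y") (auto simp: p dist_real_def field_simps)
qed

lemma lip_const_bound:
  assumes "C-lipschitz_on UNIV f"
  shows "\<bar>f x - f y\<bar> \<le> lip_const f * dist x y"
proof (cases "x = y")
  case False
  have "bdd_above (range (\<lambda>(x, y). \<bar>f x - f y\<bar> / dist x y))"
  proof (rule bdd_aboveI2)
    fix p :: "'a \<times> 'a"
    obtain x y where p: "p = (x, y)" by (cases p)
    show "(case p of (x, y) \<Rightarrow> \<bar>f x - f y\<bar> / dist x y) \<le> C"
      using lipschitz_onD[OF assms, of x y] lipschitz_on_nonneg[OF assms]
      by (cases "x = y") (auto simp: p dist_real_def field_simps)
  qed
  from cSUP_upper[OF _ this, of "(x, y)"] have "\<bar>f x - f y\<bar> / dist x y \<le> lip_const f"
    by (simp add: lip_const_def)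
  with False show ?thesis by (simp add: field_simps)
qed simp

lemma lip_const_nonneg:
  assumes "C-lipschitz_on UNIV f"
  shows "0 \<le> lip_const f"
proof -
  have "bdd_above (range (\<lambda>(x, y). \<bar>f x - f y\<bar> / dist x y))"
  proof (rule bdd_aboveI2)
    fix p :: "'a \<times> 'a"
    obtain x y where p: "p = (x, y)" by (cases p)
    show "(case p of (x, y) \<Rightarrow> \<bar>f x - f y\<bar> / dist x y) \<le> C"
      using lipschitz_onD[OF assms, of x y] lipschitz_on_nonneg[OF assms]
      by (cases "x = y") (auto simp: p dist_real_def field_simps)
  qed
  from cSUP_upper[OF _ this, of "(undefined, undefined)"] show ?thesis
    by (simp add: lip_const_def)
qed

lemma lip_const_lipschitz:
  assumes "C-lipschitz_on UNIV f"
  shows "(lip_const f)-lipschitz_on UNIV f"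
  using lip_const_bound[OF assms] lip_const_nonneg[OF assms]
  by (intro lipschitz_onI) (auto simp: dist_real_def)

instantiation lip0 :: (pointed_metric_space) real_vector
begin

lift_definition zero_lip0 :: "'a lip0" is "\<lambda>_. 0"
  by (auto simp: lipschitz_on_def intro: exI[of _ 0])

lift_definition plus_lip0 :: "'a lip0 \<Rightarrow> 'a lip0 \<Rightarrow> 'a lip0" is "\<lambda>f g x. f x + g x"
  by (auto intro: lipschitz_on_add)

lift_definition uminus_lip0 :: "'a lip0 \<Rightarrow> 'a lip0" is "\<lambda>f x. - f x"
  by (auto intro: lipschitz_on_minus)

lift_definition minus_lip0 :: "'a lip0 \<Rightarrow> 'a lip0 \<Rightarrow> 'a lip0" is "\<lambda>f g x. f x - g x"
  by (auto intro: lipschitz_on_diff)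

lift_definition scaleR_lip0 :: "real \<Rightarrow> 'a lip0 \<Rightarrow> 'a lip0" is "\<lambda>a f x. a * f x"
  by (auto intro: lipschitz_on_cmult_real)

instance
  by standard (transfer; force simp: algebra_simps)+

end

instantiation lip0 :: (pointed_metric_space) real_normed_vector
begin

lift_definition norm_lip0 :: "'a lip0 \<Rightarrow> real" is lip_const .

definition dist_lip0 :: "'a lip0 \<Rightarrow> 'a lip0 \<Rightarrow> real" where
  "dist_lip0 f g = norm (f - g)"

definition sgn_lip0 :: "'a lip0 \<Rightarrow> 'a lip0" where
  "sgn_lip0 f = f /\<^sub>R norm f"

definition uniformity_lip0 :: "('a lip0 \<times> 'a lip0) filter" where
  "uniformity_lip0 = (INF e\<in>{0<..}. principal {(x, y). dist x y < e})"

definition open_lip0 :: "'a lip0 set \<Rightarrow> bool" where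
  "open_lip0 U \<longleftrightarrow> (\<forall>x\<in>U. \<forall>\<^sub>F (x', y) in uniformity. x' = x \<longrightarrow> y \<in> U)"

instance
proof
  fix f g :: "'a lip0" and a b :: real
  show "dist f g = norm (f - g)" by (rule dist_lip0_def)
  show "sgn f = f /\<^sub>R norm f" by (rule sgn_lip0_def)
  show "(uniformity :: ('a lip0 \<times> 'a lip0) filter)
      = (INF e\<in>{0<..}. principal {(x, y). dist x y < e})"
    by (rule uniformity_lip0_def)
  show "open U \<longleftrightarrow> (\<forall>x\<in>U. \<forall>\<^sub>F (x', y) in uniformity. x' = x \<longrightarrow> y \<in> U)" for U :: "'a lip0 set"
    by (rule open_lip0_def)
  show "norm f = 0 \<longleftrightarrow> f = 0"
  proof transfer
    fix f :: "'a \<Rightarrow> real"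
    assume *: "f base_point = 0 \<and> (\<exists>C. C-lipschitz_on UNIV f)"
    then obtain C where C: "C-lipschitz_on UNIV f" by blast
    show "lip_const f = 0 \<longleftrightarrow> f = (\<lambda>_. 0)"
    proof
      assume "lip_const f = 0"
      then show "f = (\<lambda>_. 0)"
        using lip_const_bound[OF C, of _ base_point] * by auto
    next
      assume "f = (\<lambda>_. 0)"
      then have "0-lipschitz_on UNIV f" by (auto simp: lipschitz_on_def)
      then show "lip_const f = 0"
        using lip_const_le[of 0 f] lip_const_nonneg[of 0 f] by simp
    qed
  qed
  show "norm (f + g) \<le> norm f + norm g"
    by transfer (auto intro!: lip_const_le lipschitz_on_add intro: lip_const_lipschitz)
  show "norm (a *\<^sub>R f) = \<bar>a\<bar> * norm f"
  proof transfer
    fix a :: real and f :: "'a \<Rightarrow> real"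
    assume "f base_point = 0 \<and> (\<exists>C. C-lipschitz_on UNIV f)"
    then obtain C where C: "C-lipschitz_on UNIV f" by blast
    have le: "lip_const (\<lambda>x. c * h x) \<le> \<bar>c\<bar> * lip_const h"
      if "D-lipschitz_on UNIV h" for c D and h :: "'a \<Rightarrow> real"
      by (intro lip_const_le lipschitz_on_cmult_real lip_const_lipschitz[OF that])
    show "lip_const (\<lambda>x. a * f x) = \<bar>a\<bar> * lip_const f"
    proof (cases "a = 0")
      case True
      then show ?thesis
        using le[OF C, of 0] lip_const_nonneg[of 0 "\<lambda>_::'a. 0"]
        by (simp add: lipschitz_on_def)
    next
      case False
      have "lip_const f = lip_const (\<lambda>x. inverse a * (a * f x))"
        using False by (simp add: mult.assoc[symmetric])
      also have "\<dots> \<le> \<bar>inverse a\<bar> * lip_const (\<lambda>x. a * f x)"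
        by (rule le[OF lipschitz_on_cmult_real[OF C]])
      finally have "\<bar>a\<bar> * lip_const f \<le> lip_const (\<lambda>x. a * f x)"
        using False by (simp add: field_simps abs_inverse)
      with le[OF C, of a] show ?thesis by simp
    qed
  qed
qed

end

lemma lip0_apply_base [simp]: "lip0_apply f base_point = 0"
  using lip0_apply[of f] by simp

lemma lip0_apply_lipschitz: "(norm f)-lipschitz_on UNIV (lip0_apply f)"
  using lip0_apply[of f] by (auto simp: norm_lip0.rep_eq intro: lip_const_lipschitz)

instance lip0 :: (pointed_metric_space) banach
proof
  fix F :: "nat \<Rightarrow> 'a lip0"
  assume Cau: "Cauchy F"
  define G where "G n = lip0_apply (F n)" for n
  have G_diff: "\<bar>(G m x - G n x) - (G m y - G n y)\<bar> \<le> norm (F m - F n) * dist x y" for m n x y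
    using lipschitz_onD[OF lip0_apply_lipschitz[of "F m - F n"], of x y]
    by (simp add: minus_lip0.rep_eq G_def dist_real_def)
  have "Cauchy (\<lambda>n. G n x)" for x
  proof (rule metric_CauchyI)
    fix e :: real assume "0 < e"
    define d where "d = dist x base_point + 1"
    have d: "0 < d" "dist x base_point \<le> d" by (auto simp: d_def add_nonneg_pos)
    obtain N where N: "\<And>m n. m \<ge> N \<Longrightarrow> n \<ge> N \<Longrightarrow> norm (F m - F n) < e / d"
      using metric_CauchyD[OF Cau, of "e / d"] \<open>0 < e\<close> d by (auto simp: dist_norm)
    have "dist (G m x) (G n x) < e" if "m \<ge> N" "n \<ge> N" for m n
    proof -
      have "\<bar>G m x - G n x\<bar> \<le> norm (F m - F n) * dist x base_point"
        using G_diff[of m x n base_point] by (simp add: G_def)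
      also have "\<dots> \<le> norm (F m - F n) * d" using d by (simp add: mult_left_mono)
      also have "\<dots> < e" using N[OF that] d by (simp add: field_simps)
      finally show ?thesis by (simp add: dist_real_def)
    qed
    then show "\<exists>N. \<forall>m\<ge>N. \<forall>n\<ge>N. dist (G m x) (G n x) < e" by blast
  qed
  then have "\<forall>x. \<exists>l. (\<lambda>n. G n x) \<longlonglongrightarrow> l"
    by (simp add: Cauchy_convergent_iff convergent_def)
  then obtain g where g: "\<And>x. (\<lambda>n. G n x) \<longlonglongrightarrow> g x" by metis
  have close: "(e)-lipschitz_on UNIV (\<lambda>x. G m x - g x)"
    if "0 \<le> e" "\<And>n. n \<ge> N \<Longrightarrow> norm (F m - F n) \<le> e" for m N e
  proof (rule lipschitz_onI)
    fix x y
    have "(\<lambda>n. \<bar>(G m x - G n x) - (G m y - G n y)\<bar>) \<longlonglongrightarrow> \<bar>(G m x - g x) - (G m y - g y)\<bar>"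
      by (intro tendsto_intros g)
    moreover have "\<bar>(G m x - G n x) - (G m y - G n y)\<bar> \<le> e * dist x y" if "n \<ge> N" for n
      using G_diff[of m x n y] mult_right_mono[OF \<open>n \<ge> N \<Longrightarrow> norm (F m - F n) \<le> e\<close>[OF that], of "dist x y"]
      by simp
    ultimately have "\<bar>(G m x - g x) - (G m y - g y)\<bar> \<le> e * dist x y"
      by (intro LIMSEQ_le_const2[of _ _ "e * dist x y"]) auto
    then show "dist (G m x - g x) (G m y - g y) \<le> e * dist x y"
      by (simp add: dist_real_def)
  qed (use that in auto)
  have ev: "\<exists>N. \<forall>m\<ge>N. e-lipschitz_on UNIV (\<lambda>x. G m x - g x)" if "0 < e" for e
  proof -
    note e_pos = that
    obtain N where N: "\<And>m n. m \<ge> N \<Longrightarrow> n \<ge> N \<Longrightarrow> norm (F m - F n) < e"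
      using metric_CauchyD[OF Cau e_pos] by (auto simp: dist_norm)
    have "e-lipschitz_on UNIV (\<lambda>x. G m x - g x)" if "m \<ge> N" for m
      by (rule close[of e N m]) (use \<open>0 < e\<close> N that in \<open>auto intro: less_imp_le\<close>)
    then show ?thesis by blast
  qed
  obtain N where N: "1-lipschitz_on UNIV (\<lambda>x. G N x - g x)"
    using ev[of 1] by auto
  have "(norm (F N) + 1)-lipschitz_on UNIV (\<lambda>x. G N x - (G N x - g x))"
    unfolding G_def
    by (intro lipschitz_on_diff lip0_apply_lipschitz) (use N in \<open>simp add: G_def\<close>)
  moreover have "g base_point = 0"
    using g[of base_point] by (simp add: G_def LIMSEQ_const_iff)
  ultimately have "g \<in> {f. f base_point = 0 \<and> (\<exists>C. C-lipschitz_on UNIV f)}" by auto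
  from Lip0_inverse[OF this] obtain l where l: "lip0_apply l = g" by blast
  have "F \<longlonglongrightarrow> l"
  proof (rule metric_LIMSEQ_I)
    fix e :: real assume "0 < e"
    then obtain N where N: "\<And>m. m \<ge> N \<Longrightarrow> (e/2)-lipschitz_on UNIV (\<lambda>x. G m x - g x)"
      using ev[of "e/2"] by auto
    have "dist (F m) l < e" if "m \<ge> N" for m
    proof -
      have "norm (F m - l) \<le> e / 2"
        using lip_const_le[OF N[OF that]]
        by (simp add: norm_lip0.rep_eq minus_lip0.rep_eq l G_def)
      with \<open>0 < e\<close> show ?thesis by (simp add: dist_norm)
    qed
    then show "\<exists>N. \<forall>m\<ge>N. dist (F m) l < e" by blast
  qed
  then show "convergent F" by (rule convergentI)
qed

text \<open>A bounded linear map that is bounded below is a linear homeomorphism onto its range.\<close>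

definition contains_isomorphic_copy ::
    "'x::real_normed_vector itself \<Rightarrow> 'y::real_normed_vector itself \<Rightarrow> bool" where
  "contains_isomorphic_copy _ _ \<longleftrightarrow>
     (\<exists>(T :: 'x \<Rightarrow>\<^sub>L 'y) c. 0 < c \<and> (\<forall>x. c * norm x \<le> norm (blinfun_apply T x)))"

text \<open>\<open>nat \<Rightarrow>\<^sub>C real\<close> is the space of all bounded sequences with the supremum norm.\<close>

typedef c0 = "{u :: nat \<Rightarrow>\<^sub>C real. apply_bcontfun u \<longlonglongrightarrow> 0}"
  morphisms c0_seq C0
  by (rule exI[of _ 0]) simp

setup_lifting type_definition_c0

instantiation c0 :: real_vector
begin

lift_definition zero_c0 :: c0 is 0 by simp

lift_definition plus_c0 :: "c0 \<Rightarrow> c0 \<Rightarrow> c0" is "(+)"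
  by (auto intro: tendsto_add_zero)

lift_definition uminus_c0 :: "c0 \<Rightarrow> c0" is uminus
  using tendsto_minus by fastforce

lift_definition minus_c0 :: "c0 \<Rightarrow> c0 \<Rightarrow> c0" is "(-)"
  using tendsto_diff by fastforce

lift_definition scaleR_c0 :: "real \<Rightarrow> c0 \<Rightarrow> c0" is "(*\<^sub>R)"
  by (auto intro: tendsto_mult_right_zero)

instance
  by standard (transfer; simp add: algebra_simps)+

end

instantiation c0 :: real_normed_vector
begin

lift_definition norm_c0 :: "c0 \<Rightarrow> real" is norm .

lift_definition dist_c0 :: "c0 \<Rightarrow> c0 \<Rightarrow> real" is dist .

definition sgn_c0 :: "c0 \<Rightarrow> c0" where
  "sgn_c0 u = u /\<^sub>R norm u"

definition uniformity_c0 :: "(c0 \<times> c0) filter" where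
  "uniformity_c0 = (INF e\<in>{0<..}. principal {(x, y). dist x y < e})"

definition open_c0 :: "c0 set \<Rightarrow> bool" where
  "open_c0 U \<longleftrightarrow> (\<forall>x\<in>U. \<forall>\<^sub>F (x', y) in uniformity. x' = x \<longrightarrow> y \<in> U)"

instance
proof
  fix u v :: c0 and a :: real
  show "sgn u = u /\<^sub>R norm u" by (rule sgn_c0_def)
  show "(uniformity :: (c0 \<times> c0) filter)
      = (INF e\<in>{0<..}. principal {(x, y). dist x y < e})"
    by (rule uniformity_c0_def)
  show "open U \<longleftrightarrow> (\<forall>x\<in>U. \<forall>\<^sub>F (x', y) in uniformity. x' = x \<longrightarrow> y \<in> U)" for U :: "c0 set"
    by (rule open_c0_def)
  show "dist u v = norm (u - v)" by transfer (rule dist_norm)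
  show "norm (u + v) \<le> norm u + norm v" by transfer (rule norm_triangle_ineq)
  show "norm u = 0 \<longleftrightarrow> u = 0" by transfer (rule norm_eq_zero)
  show "norm (a *\<^sub>R u) = \<bar>a\<bar> * norm u" by transfer (rule norm_scaleR)
qed

end

definition contains_bilipschitz_copy ::
    "'m::metric_space itself \<Rightarrow> 'n::metric_space set \<Rightarrow> bool" where
  "contains_bilipschitz_copy _ S \<longleftrightarrow>
     (\<exists>(h :: 'n \<Rightarrow> 'm) c C. 0 < c \<and> 0 < C \<and>
        (\<forall>x\<in>S. \<forall>y\<in>S. c * dist x y \<le> dist (h x) (h y) \<and> dist (h x) (h y) \<le> C * dist x y))"

definition lipschitz_extension_property :: "'n itself \<Rightarrow> 'q metric \<Rightarrow> bool" where
  "lipschitz_extension_property _ Q \<longleftrightarrow>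
     (\<forall>(N :: 'n metric) P f.
        P \<subseteq> mspace N \<and> Lipschitz_continuous_map (submetric N P) Q f \<longrightarrow>
        (\<exists>g. Lipschitz_continuous_map N Q g \<and> (\<forall>x\<in>P. g x = f x)))"

text \<open>A definition cannot quantify over all types, hence over all metric spaces, so the ambient
  spaces range over the metric spaces whose points are real functions on the type of \<open>Q\<close>.
  This is no restriction: \<open>absolute_lipschitz_retract_extension\<close> below gives the extension
  property for ambient spaces over an arbitrary type.\<close>

definition absolute_lipschitz_retract :: "'q metric \<Rightarrow> bool" where
  "absolute_lipschitz_retract Q \<longleftrightarrow> lipschitz_extension_property TYPE('q \<Rightarrow> real) Q"

lemma mdist_same: "x \<in> mspace N \<Longrightarrow> mdist N x x = 0"
  by simp

lemma mcshane_extension: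
  fixes N :: "'n metric" and g :: "'n \<Rightarrow> real"
  assumes P: "P \<subseteq> mspace N" "p0 \<in> P" and B: "0 \<le> B"
    and g: "\<And>p q. p \<in> P \<Longrightarrow> q \<in> P \<Longrightarrow> \<bar>g p - g q\<bar> \<le> B * mdist N p q"
  shows "\<exists>G. (\<forall>p\<in>P. G p = g p) \<and>
    (\<forall>x\<in>mspace N. \<forall>y\<in>mspace N. \<bar>G x - G y\<bar> \<le> B * mdist N x y)"
proof -
  define G where "G x = (INF p\<in>P. g p + B * mdist N x p)" for x
  have lower: "g q - B * mdist N x q \<le> g p + B * mdist N x p"
    if "x \<in> mspace N" "p \<in> P" "q \<in> P" for x p q
  proof -
    have "mdist N q p \<le> mdist N x q + mdist N x p"
      using that P mdist_triangle[of q N x p] by (auto simp: mdist_commute subset_iff)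
    then have "B * mdist N q p \<le> B * mdist N x q + B * mdist N x p"
      using mult_left_mono[OF _ B] by (metis distrib_left)
    with g[of q p] that show ?thesis by auto
  qed
  have bdd: "bdd_below ((\<lambda>p. g p + B * mdist N x p) ` P)" if "x \<in> mspace N" for x
    by (rule bdd_belowI2[of _ "g p0 - B * mdist N x p0"]) (use lower that P in auto)
  have "G p = g p" if "p \<in> P" for p
  proof (rule antisym)
    have pN: "p \<in> mspace N" using that P by auto
    show "G p \<le> g p"
      unfolding G_def using cINF_lower[OF bdd[OF pN] that] mdist_same[OF pN] by simp
    show "g p \<le> G p"
      unfolding G_def by (rule cINF_greatest) (use lower[OF pN _ that] mdist_same[OF pN] P in auto)
  qed
  moreover have half: "G x \<le> G y + B * mdist N x y"
    if "x \<in> mspace N" "y \<in> mspace N" for x y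
  proof -
    have "G x - B * mdist N x y \<le> g p + B * mdist N y p" if p: "p \<in> P" for p
    proof -
      have "G x \<le> g p + B * mdist N x p"
        unfolding G_def by (rule cINF_lower[OF bdd p]) fact
      moreover have "mdist N x p \<le> mdist N x y + mdist N y p"
        using \<open>x \<in> mspace N\<close> \<open>y \<in> mspace N\<close> p P by (intro mdist_triangle) auto
      then have "B * mdist N x p \<le> B * mdist N x y + B * mdist N y p"
        using mult_left_mono[OF _ B] by (metis distrib_left)
      ultimately show ?thesis by simp
    qed
    then have "G x - B * mdist N x y \<le> G y"
      unfolding G_def[of y] using P by (intro cINF_greatest) auto
    then show ?thesis by simp
  qed
  have "\<bar>G x - G y\<bar> \<le> B * mdist N x y" if "x \<in> mspace N" "y \<in> mspace N" for x y
    using half[of x y] half[of y x] that by (simp add: mdist_commute abs_le_iff)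
  ultimately show ?thesis by blast
qed

lemma absolute_lipschitz_retract_extension:
  assumes "absolute_lipschitz_retract Q"
  shows "lipschitz_extension_property TYPE('n) Q"
  unfolding lipschitz_extension_property_def
proof (intro allI impI, elim conjE)
  fix N :: "'n metric" and P f
  assume P: "P \<subseteq> mspace N" and f: "Lipschitz_continuous_map (submetric N P) Q f"
  have ext: "\<exists>g. Lipschitz_continuous_map N' Q g \<and> (\<forall>x\<in>P'. g x = f' x)"
    if "P' \<subseteq> mspace N'" "Lipschitz_continuous_map (submetric N' P') Q f'"
    for N' :: "('a \<Rightarrow> real) metric" and P' f'
    using assms that
    unfolding absolute_lipschitz_retract_def lipschitz_extension_property_def by blast
  define S where "S = mspace Q"
  define L where "L = funspace S (euclidean_metric :: real metric)"
  have "(\<lambda>x\<in>S. 0) \<in> mspace L"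
    by (auto simp: L_def Met_TC.fspace_def bounded_iff intro: exI[of _ 0])
  moreover obtain g0 where "Lipschitz_continuous_map L Q g0"
    using ext[of "{}" L "\<lambda>_. undefined"] by (auto simp: Lipschitz_continuous_map_def)
  ultimately obtain q0 where q0: "q0 \<in> S"
    using Lipschitz_continuous_map_image S_def by blast
  then have S_ne: "S \<noteq> {}" by blast
  have L_mem: "u \<in> mspace L" if "u \<in> extensional S" "\<And>z. z \<in> S \<Longrightarrow> \<bar>u z\<bar> \<le> K" for u K
    using that by (auto simp: L_def Met_TC.fspace_def bounded_iff intro!: exI[of _ K])
  have L_dist: "mdist L u v = (SUP z\<in>S. \<bar>u z - v z\<bar>)" "bdd_above ((\<lambda>z. \<bar>u z - v z\<bar>) ` S)"
    if "u \<in> mspace L" "v \<in> mspace L" for u v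
    using that S_ne Met_TC.bdd_above_dist[of u S v]
    by (simp_all add: L_def Met_TC.fdist_def dist_real_def)
  have L_dist_le: "mdist L u v \<le> K"
    if "u \<in> mspace L" "v \<in> mspace L" "\<And>z. z \<in> S \<Longrightarrow> \<bar>u z - v z\<bar> \<le> K" for u v K
    unfolding L_dist(1)[OF that(1,2)] using q0 that by (intro cSUP_least) auto
  have le_L_dist: "\<bar>u z - v z\<bar> \<le> mdist L u v"
    if "u \<in> mspace L" "v \<in> mspace L" "z \<in> S" for u v z
    unfolding L_dist(1)[OF that(1,2)] using L_dist(2)[OF that(1,2)] that by (intro cSUP_upper)

  define \<phi> where "\<phi> x = (\<lambda>z\<in>S. mdist Q x z - mdist Q q0 z)" for x
  have tri: "\<bar>mdist Q x z - mdist Q y z\<bar> \<le> mdist Q x y"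
    if "x \<in> S" "y \<in> S" "z \<in> S" for x y z
    using that mdist_triangle[of x Q y z] mdist_triangle[of y Q x z]
    by (auto simp: S_def mdist_commute)
  have \<phi>_L: "\<phi> x \<in> mspace L" if "x \<in> S" for x
    by (rule L_mem[of _ "mdist Q x q0"]) (use that tri q0 in \<open>auto simp: \<phi>_def\<close>)
  have \<phi>_ge: "mdist Q x y \<le> mdist L (\<phi> x) (\<phi> y)" if "x \<in> S" "y \<in> S" for x y
    using le_L_dist[OF \<phi>_L \<phi>_L, of x y y] that mdist_same[of y Q]
    by (simp add: \<phi>_def S_def)
  have \<phi>_inj: "inj_on \<phi> S"
  proof (rule inj_onI)
    fix x y assume xy: "x \<in> S" "y \<in> S" "\<phi> x = \<phi> y"
    then have "mdist Q x y \<le> 0"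
      using \<phi>_ge[of x y] mdist_same[OF \<phi>_L[of y]] by simp
    then show "x = y"
      using xy mdist_zero[of x Q y] mdist_nonneg[of Q x y] by (simp add: S_def)
  qed
  have "Lipschitz_continuous_map (submetric L (\<phi> ` S)) Q (inv_into S \<phi>)"
    unfolding Lipschitz_continuous_map_def
    by (auto simp: inv_into_f_f[OF \<phi>_inj] S_def[symmetric] intro!: exI[of _ 1] \<phi>_ge)
  moreover have "\<phi> ` S \<subseteq> mspace L" using \<phi>_L by auto
  ultimately obtain r where r: "Lipschitz_continuous_map L Q r" "\<And>x. x \<in> S \<Longrightarrow> r (\<phi> x) = x"
    using ext[of "\<phi> ` S" L "inv_into S \<phi>"] \<phi>_inj by auto

  show "\<exists>g. Lipschitz_continuous_map N Q g \<and> (\<forall>x\<in>P. g x = f x)"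
  proof (cases "P = {}")
    case True
    then show ?thesis
      using q0 by (intro exI[of _ "\<lambda>_. q0"]) (auto simp: S_def Lipschitz_continuous_map_const)
  next
    case False
    then obtain p0 where p0: "p0 \<in> P" by blast
    obtain B where fS: "\<And>p. p \<in> P \<Longrightarrow> f p \<in> S" and B: "0 < B"
      "\<And>p q. p \<in> P \<Longrightarrow> q \<in> P \<Longrightarrow> mdist Q (f p) (f q) \<le> B * mdist N p q"
      using f P unfolding Lipschitz_continuous_map_pos S_def
      by (auto simp: Pi_iff Int_absorb2)
    have "\<exists>G. (\<forall>p\<in>P. G p = \<phi> (f p) z) \<and>
        (\<forall>x\<in>mspace N. \<forall>y\<in>mspace N. \<bar>G x - G y\<bar> \<le> B * mdist N x y)" if "z \<in> S" for z
    proof (rule mcshane_extension[OF P p0])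
      fix p q assume "p \<in> P" "q \<in> P"
      then show "\<bar>\<phi> (f p) z - \<phi> (f q) z\<bar> \<le> B * mdist N p q"
        using tri[of "f p" "f q" z] fS B(2)[of p q] that by (auto simp: \<phi>_def)
    qed (use B in simp)
    then obtain G where G: "\<And>z p. z \<in> S \<Longrightarrow> p \<in> P \<Longrightarrow> G z p = \<phi> (f p) z"
      "\<And>z x y. z \<in> S \<Longrightarrow> x \<in> mspace N \<Longrightarrow> y \<in> mspace N \<Longrightarrow> \<bar>G z x - G z y\<bar> \<le> B * mdist N x y"
      by metis
    define H where "H x = (\<lambda>z\<in>S. G z x)" for x
    have H_L: "H x \<in> mspace L" if x: "x \<in> mspace N" for x
    proof (rule L_mem[of _ "mdist Q (f p0) q0 + B * mdist N x p0"])
      fix z assume z: "z \<in> S"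
      have "\<bar>G z p0\<bar> \<le> mdist Q (f p0) q0"
        using tri[of "f p0" q0 z] fS[OF p0] q0 z G(1)[OF z p0] by (simp add: \<phi>_def)
      then show "\<bar>H x z\<bar> \<le> mdist Q (f p0) q0 + B * mdist N x p0"
        using G(2)[OF z x, of p0] p0 P z by (auto simp: H_def)
    qed (simp add: H_def)
    have "Lipschitz_continuous_map N L H"
      unfolding Lipschitz_continuous_map_def
    proof (intro conjI exI[of _ B] ballI)
      fix x y assume xy: "x \<in> mspace N" "y \<in> mspace N"
      show "mdist L (H x) (H y) \<le> B * mdist N x y"
        by (rule L_dist_le) (use xy H_L G(2) in \<open>auto simp: H_def\<close>)
    qed (use H_L in auto)
    then have "Lipschitz_continuous_map N Q (r \<circ> H)"
      using r(1) Lipschitz_continuous_map_compose by blast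
    moreover have "(r \<circ> H) p = f p" if "p \<in> P" for p
    proof -
      have "H p = \<phi> (f p)"
        using G(1)[OF _ that] by (auto simp: H_def \<phi>_def fun_eq_iff)
      then show ?thesis using r(2) fS that by simp
    qed
    ultimately show ?thesis by blast
  qed
qed

end

theory Submission
  imports Defs
begin

text \<open>The dual of \<open>c0\<close> is \<open>\<ell>\<^sub>1\<close>, which is not a Grothendieck space: the functionals
  \<open>a \<mapsto> \<Sum>\<^sub>k\<^sub>\<ge>\<^sub>n a\<^sub>k\<close> tend to \<open>0\<close> on every
  \<open>a \<in> \<ell>\<^sub>1\<close>, but a generalised limit along the unit vectors \<open>e\<^sub>j\<close> of
  \<open>\<ell>\<^sub>1\<close>, which is an element of the bidual, has the value \<open>1\<close> at all of them. The proof
  transports this example to \<open>Lip\<^sub>0(M)\<close> by means of a linear map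
  \<open>Lip\<^sub>0(M) \<rightarrow> \<ell>\<^sub>1\<close> that sends a Lipschitz function to its averaged gradient.

  Since \<open>E\<close> contains \<open>c0\<close>, radial projection carries the sphere of \<open>c0\<close> into the sphere of
  \<open>E\<close> in a bilipschitz way (\<open>bilipschitz_copy_sphere_isomorphic_copy\<close>), so \<open>M\<close> contains a
  bilipschitz copy of the sphere of \<open>c0\<close>. That sphere contains the face where coordinate
  \<open>0\<close> equals \<open>1\<close>, and this face contains isometric copies of all cubes
  \<open>[0, 1]\<^sup>m\<close> with the maximum metric. For \<open>g\<close> Lipschitz on the sphere, the slope of \<open>g\<close>
  in direction \<open>k\<close> is a generalised limit, as \<open>m\<close> grows, of the mean over a grid in the
  cube of the difference quotients of \<open>g\<close> in direction \<open>k\<close> with step \<open>1 / (m + 1)\<close>. Moving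
  the grid by one step changes means only negligibly (\<open>avg_raise_tendsto\<close>), so the sum of the
  slopes over a finite set \<open>A\<close> of directions equals the averaged difference quotient for one
  simultaneous step in all directions of \<open>A\<close>. Such a step has length \<open>1 / (m + 1)\<close> in the
  maximum norm, whatever the size of \<open>A\<close>; hence the sum is at most the Lipschitz constant of
  \<open>g\<close> (\<open>sum_slope_bound\<close>), and the sequence of slopes is in \<open>\<ell>\<^sub>1\<close>. Finally, the
  \<open>j\<close>-th coordinate function extends from the copy of the sphere to \<open>M\<close> with a Lipschitz
  constant that does not depend on \<open>j\<close>; the extension is mapped to the unit vector
  \<open>e\<^sub>j\<close>, and the two parts of the example are in place.\<close>

section \<open>Limits of bounded sequences along a filter\<close>

text \<open>Along such a filter \<open>Lim\<close> is a linear functional on the bounded sequences that extends the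
  ordinary limit. It is needed for the slopes and for an element of the bidual.\<close>

locale universal_filter =
  fixes F :: "nat filter"
  assumes nontrivial: "F \<noteq> bot"
    and le_sequentially: "F \<le> sequentially"
    and bounded_imp_tendsto: "bounded (range (f :: nat \<Rightarrow> real)) \<Longrightarrow> \<exists>l. (f \<longlongrightarrow> l) F"

text \<open>Map \<open>n\<close> to the family of the values at \<open>n\<close> of all bounded sequences. By Tychonoff's theorem
  these families lie in a compact product, so they have a cluster point; the indices whose families
  are close to it form the filter.\<close>

lemma ex_universal_filter: "\<exists>F. universal_filter F"
proof -
  \<comment> \<open>Unbounded sequences are replaced by \<open>0\<close>, so that every factor of the product is compact.\<close>
  define e :: "nat \<Rightarrow> (nat \<Rightarrow> real) \<Rightarrow> real"
    where "e n f = (if bounded (range f) then f n else 0)" for n f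
  define S where "S f = closure (range (\<lambda>n. e n f))" for f
  have "compact (S f)" for f
  proof -
    have "bounded (range (\<lambda>n. e n f))"
    proof (cases "bounded (range f)")
      case True
      then show ?thesis by (simp add: e_def)
    next
      case False
      then have "range (\<lambda>n. e n f) = {0}" by (auto simp: e_def)
      then show ?thesis by simp
    qed
    then show ?thesis by (simp add: S_def compact_closure)
  qed
  then have "compactin (product_topology (\<lambda>_. euclidean) UNIV) (Pi\<^sub>E UNIV S)"
    by (simp add: compactin_PiE)
  then have "compact (Pi\<^sub>E UNIV S)"
    by (simp add: euclidean_product_topology)
  moreover have "filtermap e sequentially \<noteq> bot"
    by (simp add: filtermap_bot_iff)
  moreover have "eventually (\<lambda>x. x \<in> Pi\<^sub>E UNIV S) (filtermap e sequentially)"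
  proof -
    have "e n f \<in> S f" for n f
      unfolding S_def by (rule subsetD[OF closure_subset]) simp
    then show ?thesis by (simp add: eventually_filtermap PiE_UNIV_domain)
  qed
  ultimately obtain l where l: "inf (nhds l) (filtermap e sequentially) \<noteq> bot"
    by (auto simp: compact_filter)
  define F where "F = inf (filtercomap e (nhds l)) sequentially"
  have "F \<noteq> bot"
  proof
    assume "F = bot"
    then obtain Q R where QR: "eventually Q (nhds l)" "eventually R sequentially"
      and disj: "\<And>n. Q (e n) \<Longrightarrow> R n \<Longrightarrow> False"
      unfolding F_def trivial_limit_def eventually_inf eventually_filtercomap by blast
    have "eventually (\<lambda>x. \<not> Q x) (filtermap e sequentially)"
      unfolding eventually_filtermap using QR(2) by eventually_elim (use disj in blast)
    with QR(1) have "eventually (\<lambda>_. False) (inf (nhds l) (filtermap e sequentially))"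
      unfolding eventually_inf by blast
    with l show False by (simp add: trivial_limit_def)
  qed
  moreover have "F \<le> sequentially" by (simp add: F_def)
  moreover have "(f \<longlongrightarrow> l f) F" if "bounded (range f)" for f
  proof -
    have "((\<lambda>g. g f) \<longlongrightarrow> l f) (nhds l)"
      by (rule continuous_on_tendsto_compose[where f = "\<lambda>g. g f" and g = "\<lambda>x. x" and s = UNIV])
        (simp_all add: continuous_on_product_coordinates filterlim_ident)
    then have "((\<lambda>n. e n f) \<longlongrightarrow> l f) (filtercomap e (nhds l))"
      using filterlim_compose filterlim_filtercomap by blast
    then have "((\<lambda>n. e n f) \<longlongrightarrow> l f) F"
      unfolding F_def by (rule filterlim_mono) auto
    with that show ?thesis by (simp add: e_def)
  qed
  ultimately have "universal_filter F" by unfold_locales auto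
  then show ?thesis by blast
qed

context universal_filter
begin

lemma tendsto_Lim_bounded:
  fixes f :: "nat \<Rightarrow> real"
  assumes "\<And>n. \<bar>f n\<bar> \<le> C"
  shows "(f \<longlongrightarrow> Lim F f) F"
proof -
  have "bounded (range f)" using assms by (auto simp: bounded_iff)
  then obtain l where "(f \<longlongrightarrow> l) F" using bounded_imp_tendsto by blast
  with nontrivial show ?thesis using tendsto_Lim by blast
qed

lemma Lim_sequential:
  fixes f :: "nat \<Rightarrow> real"
  assumes "f \<longlonglongrightarrow> l"
  shows "Lim F f = l"
  using assms nontrivial le_sequentially by (intro tendsto_Lim) (auto intro: filterlim_mono)

end

section \<open>Averages over grids\<close>

text \<open>Only the coordinates \<open>1, ..., m\<close> vary: coordinate \<open>0\<close> is kept for holding the norm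
  of the corresponding points of \<open>c0\<close> at \<open>1\<close>.\<close>

definition grid :: "nat \<Rightarrow> (nat \<Rightarrow> nat) set" where
  "grid m = (\<Pi>\<^sub>E i\<in>{1..m}. {..m})"

definition avg :: "nat \<Rightarrow> ((nat \<Rightarrow> nat) \<Rightarrow> real) \<Rightarrow> real" where
  "avg m h = (\<Sum>x\<in>grid m. h x) / real (card (grid m))"

definition raise :: "nat set \<Rightarrow> (nat \<Rightarrow> nat) \<Rightarrow> nat \<Rightarrow> nat" where
  "raise A x i = (if i \<in> A then Suc (x i) else x i)"

lemma raise_insert: "k \<notin> A \<Longrightarrow> raise (insert k A) x = raise {k} (raise A x)"
  by (auto simp: raise_def fun_eq_iff)

lemma raise_empty [simp]: "raise {} x = x"
  by (auto simp: raise_def fun_eq_iff)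

lemma finite_grid [simp]: "finite (grid m)"
  by (simp add: grid_def finite_PiE)

lemma card_grid: "card (grid m) = Suc m ^ m"
  by (simp add: grid_def card_PiE)

lemma card_grid_pos: "card (grid m) > 0"
  by (simp add: card_grid)

lemma avg_const: "(\<And>x. x \<in> grid m \<Longrightarrow> h x = c) \<Longrightarrow> avg m h = c"
  using card_grid_pos[of m] by (auto simp: avg_def)

lemma avg_add: "avg m (\<lambda>x. f x + g x) = avg m f + avg m g"
  by (simp add: avg_def sum.distrib add_divide_distrib)

lemma avg_cmult: "avg m (\<lambda>x. c * f x) = c * avg m f"
  by (simp add: avg_def sum_distrib_left)

lemma avg_bound:
  assumes "\<And>x. \<bar>h x\<bar> \<le> C"
  shows "\<bar>avg m h\<bar> \<le> C"
proof -
  have "\<bar>\<Sum>x\<in>grid m. h x\<bar> \<le> (\<Sum>x\<in>grid m. \<bar>h x\<bar>)" by (rule sum_abs)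
  also have "\<dots> \<le> real (card (grid m)) * C" using assms by (intro sum_bounded_above)
  finally show ?thesis using card_grid_pos[of m] by (simp add: avg_def field_simps)
qed

text \<open>Raising coordinate \<open>k\<close> moves the grid to a box that differs from it only by two opposite faces,
  and each face has \<open>1 / (m + 1)\<close> as many points as the grid.\<close>

lemma avg_raise_bound:
  assumes h: "\<And>x. \<bar>h x\<bar> \<le> C" and k: "k \<in> {1..m}"
  shows "\<bar>avg m (\<lambda>x. h (raise {k} x)) - avg m h\<bar> \<le> 2 * C / real (Suc m)"
proof -
  define slab where "slab T = (\<Pi>\<^sub>E i\<in>{1..m}. if i = k then T else {..m})" for T :: "nat set"
  have slab_iff: "x \<in> slab T \<longleftrightarrow>
      x k \<in> T \<and> (\<forall>i\<in>{1..m} - {k}. x i \<le> m) \<and> (\<forall>i. i \<notin> {1..m} \<longrightarrow> x i = undefined)" for x T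
    using k by (auto simp: slab_def PiE_iff extensional_def)
  have grid_slab: "grid m = slab {..m}"
    unfolding grid_def slab_def by (rule PiE_cong) auto
  have fin: "finite (slab T)" if "finite T" for T
    using that by (auto simp: slab_def intro: finite_PiE)
  have card1: "card (slab {t}) = Suc m ^ (m - 1)" for t
  proof -
    have "card (slab {t}) = (\<Prod>i\<in>{1..m}. card (if i = k then {t} else {..m}))"
      by (simp add: slab_def card_PiE)
    also have "\<dots> = (\<Prod>i\<in>{1..m} - {k}. Suc m)"
      using k by (subst prod.remove[of _ k]) auto
    finally show ?thesis using k by simp
  qed
  have inj: "inj_on (raise {k}) (grid m)"
    by (rule inj_onI) (auto simp: raise_def fun_eq_iff split: if_splits)
  have img: "raise {k} ` grid m = slab {1..Suc m}"
  proof (intro equalityI subsetI)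
    fix y assume "y \<in> raise {k} ` grid m"
    then show "y \<in> slab {1..Suc m}"
      unfolding grid_slab using k by (auto simp: slab_iff raise_def split: if_splits)
  next
    fix y assume y: "y \<in> slab {1..Suc m}"
    define x where "x = y(k := y k - 1)"
    have "y = raise {k} x"
      using y by (auto simp: slab_iff x_def raise_def fun_eq_iff)
    moreover have "x \<in> grid m"
      unfolding grid_slab using y k by (auto simp: slab_iff x_def)
    ultimately show "y \<in> raise {k} ` grid m" by blast
  qed
  have slab_Un: "slab (A \<union> B) = slab A \<union> slab B" for A B
    by (auto simp: slab_iff)
  have "{1..Suc m} = {1..m} \<union> {Suc m}" "{..m} = {1..m} \<union> {0}" by auto
  then have split1: "slab {1..Suc m} = slab {1..m} \<union> slab {Suc m}"
    and split2: "slab {..m} = slab {1..m} \<union> slab {0}"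
    by (metis slab_Un)+
  have disj: "slab {1..m} \<inter> slab {Suc m} = {}" "slab {1..m} \<inter> slab {0} = {}"
    by (auto simp: slab_iff)
  have "(\<Sum>x\<in>grid m. h (raise {k} x)) = sum h (slab {1..Suc m})"
    unfolding img[symmetric] by (simp add: sum.reindex[OF inj])
  also have "\<dots> = sum h (slab {1..m}) + sum h (slab {Suc m})"
    unfolding split1 by (rule sum.union_disjoint) (use fin disj in auto)
  finally have 1: "(\<Sum>x\<in>grid m. h (raise {k} x)) = sum h (slab {1..m}) + sum h (slab {Suc m})" .
  have 2: "sum h (grid m) = sum h (slab {1..m}) + sum h (slab {0})"
    unfolding grid_slab split2 by (rule sum.union_disjoint) (use fin disj in auto)
  have bd: "\<bar>sum h (slab {t})\<bar> \<le> real (Suc m ^ (m - 1)) * C" for t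
  proof -
    have "\<bar>sum h (slab {t})\<bar> \<le> (\<Sum>x\<in>slab {t}. \<bar>h x\<bar>)" by (rule sum_abs)
    also have "\<dots> \<le> real (card (slab {t})) * C" using h by (intro sum_bounded_above)
    finally show ?thesis by (simp only: card1)
  qed
  have pw: "real (card (grid m)) = real (Suc m) * real (Suc m ^ (m - 1))"
    using k by (cases m) (simp_all add: card_grid algebra_simps)
  have "\<bar>(\<Sum>x\<in>grid m. h (raise {k} x)) - sum h (grid m)\<bar> \<le> 2 * C * real (Suc m ^ (m - 1))"
    using bd[of 0] bd[of "Suc m"] unfolding 1 2 mult.assoc[of 2] mult.commute[of C] by linarith
  then have "\<bar>(\<Sum>x\<in>grid m. h (raise {k} x)) - sum h (grid m)\<bar> / real (card (grid m))
      \<le> 2 * C * real (Suc m ^ (m - 1)) / real (card (grid m))"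
    by (rule divide_right_mono) simp
  also have "\<dots> = 2 * C / real (Suc m)"
    unfolding pw by (simp del: of_nat_Suc of_nat_power)
  finally show ?thesis by (simp add: avg_def diff_divide_distrib[symmetric])
qed

text \<open>Several coordinates can be raised one after the other. The error for each of them tends to
  \<open>0\<close>, so their number does not matter in the limit.\<close>

lemma avg_raise_tendsto:
  assumes "finite A" "0 \<notin> A" and h: "\<And>m x. \<bar>h m x\<bar> \<le> C"
  shows "(\<lambda>m. avg m (\<lambda>x. h m (raise A x)) - avg m (h m)) \<longlonglongrightarrow> 0"
  using assms(1,2)
proof (induction A)
  case empty
  then show ?case by simp
next
  case (insert k A)
  have "(\<lambda>m. avg m (\<lambda>x. h m (raise (insert k A) x)) - avg m (\<lambda>x. h m (raise A x))) \<longlonglongrightarrow> 0"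
  proof (rule Lim_null_comparison)
    have "(\<lambda>m. 2 * C * inverse (real (Suc m))) \<longlonglongrightarrow> 2 * C * 0"
      by (intro tendsto_intros LIMSEQ_inverse_real_of_nat)
    then show "(\<lambda>m. 2 * C / real (Suc m)) \<longlonglongrightarrow> 0" by (simp add: divide_inverse)
    have comm: "raise (insert k A) x = raise A (raise {k} x)" for x
      by (auto simp: raise_def fun_eq_iff insert.hyps)
    show "\<forall>\<^sub>F m in sequentially. norm (avg m (\<lambda>x. h m (raise (insert k A) x)) - avg m (\<lambda>x. h m (raise A x)))
        \<le> 2 * C / real (Suc m)"
      using eventually_ge_at_top[of k]
    proof eventually_elim
      case (elim m)
      then show ?case
        unfolding comm real_norm_def using insert.prems
        by (intro avg_raise_bound[where h = "\<lambda>x. h m (raise A x)"] h) (cases k; simp)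
    qed
  qed
  from tendsto_add[OF this insert.IH] insert.prems show ?case by simp
qed

section \<open>Averaged slopes\<close>

lemma ex_c0:
  assumes "v \<longlonglongrightarrow> 0"
  shows "\<exists>u. apply_bcontfun (c0_seq u) = v"
proof -
  have "v \<in> bcontfun"
    using convergent_imp_bounded[OF assms] by (auto simp: bcontfun_def)
  then have "apply_bcontfun (Bcontfun v) = v" by (rule Bcontfun_inverse)
  then show ?thesis using C0_inverse[of "Bcontfun v"] assms by (intro exI[of _ "C0 (Bcontfun v)"]) simp
qed

text \<open>The minimum with \<open>1\<close> keeps the points in the unit ball for arguments outside the grid,
  so that bounds on the difference quotients hold at all arguments. It has no effect on the grid
  and on the points one step above it.\<close>

definition coords :: "nat \<Rightarrow> (nat \<Rightarrow> nat) \<Rightarrow> nat \<Rightarrow> real" where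
  "coords m x i = (if i = 0 then 1 else if i \<le> m then min 1 (real (x i) / real (Suc m)) else 0)"

definition point :: "nat \<Rightarrow> (nat \<Rightarrow> nat) \<Rightarrow> c0" where
  "point m x = (SOME u. apply_bcontfun (c0_seq u) = coords m x)"

lemma coords_tendsto: "coords m x \<longlonglongrightarrow> 0"
  by (rule tendsto_eventually, rule eventually_sequentiallyI[of "Suc m"]) (simp add: coords_def)

lemma point_coords [simp]: "apply_bcontfun (c0_seq (point m x)) = coords m x"
  unfolding point_def by (rule someI_ex) (rule ex_c0[OF coords_tendsto])

lemma dist_c0_le: "(\<And>i. \<bar>apply_bcontfun (c0_seq u) i - apply_bcontfun (c0_seq v) i\<bar> \<le> b) \<Longrightarrow> dist u v \<le> b"
  unfolding dist_c0.rep_eq by (rule dist_bound) (simp add: dist_real_def)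

lemma c0_coord_le: "\<bar>apply_bcontfun (c0_seq u) i - apply_bcontfun (c0_seq v) i\<bar> \<le> dist u v"
  unfolding dist_c0.rep_eq using dist_bounded[of "c0_seq u" i "c0_seq v"] by (simp add: dist_real_def)

lemma point_in_sphere: "point m x \<in> sphere 0 1"
proof -
  have "dist (point m x) 0 \<le> 1"
    by (rule dist_c0_le) (auto simp: coords_def zero_c0.rep_eq)
  moreover have "1 \<le> dist (point m x) 0"
    using c0_coord_le[of "point m x" 0 0] by (simp add: coords_def zero_c0.rep_eq)
  ultimately show ?thesis by (simp add: dist_commute)
qed

text \<open>This is where the supremum norm enters: a step in all directions of \<open>A\<close> at once is not
  longer than a step in one direction.\<close>

lemma dist_point_raise: "dist (point m (raise A x)) (point m x) \<le> 1 / real (Suc m)"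
proof (rule dist_c0_le)
  fix i
  have "\<bar>min 1 s - min 1 t\<bar> \<le> d" if "\<bar>s - t\<bar> \<le> d" for s t d :: real
    using that by (auto simp: min_def)
  moreover have "\<bar>real (raise A x i) / real (Suc m) - real (x i) / real (Suc m)\<bar> \<le> 1 / real (Suc m)"
    by (auto simp: raise_def simp flip: diff_divide_distrib)
  ultimately show "\<bar>apply_bcontfun (c0_seq (point m (raise A x))) i
      - apply_bcontfun (c0_seq (point m x)) i\<bar> \<le> 1 / real (Suc m)"
    by (auto simp: coords_def)
qed

definition diff_quot :: "(c0 \<Rightarrow> real) \<Rightarrow> nat set \<Rightarrow> nat \<Rightarrow> (nat \<Rightarrow> nat) \<Rightarrow> real" where
  "diff_quot g A m x = real (Suc m) * (g (point m (raise A x)) - g (point m x))"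

lemma diff_quot_bound:
  assumes "L-lipschitz_on (sphere 0 1) g"
  shows "\<bar>diff_quot g A m x\<bar> \<le> L"
proof -
  have "\<bar>g (point m (raise A x)) - g (point m x)\<bar> \<le> L * dist (point m (raise A x)) (point m x)"
    using lipschitz_onD[OF assms point_in_sphere point_in_sphere] by (simp add: dist_real_def)
  also have "\<dots> \<le> L * (1 / real (Suc m))"
    using lipschitz_on_nonneg[OF assms] dist_point_raise by (rule mult_left_mono[rotated])
  finally have "\<bar>g (point m (raise A x)) - g (point m x)\<bar> * real (Suc m) \<le> L"
    by (simp add: pos_le_divide_eq del: of_nat_Suc)
  then show ?thesis by (simp add: diff_quot_def abs_mult mult.commute del: of_nat_Suc)
qed

text \<open>A step in the directions of \<open>A\<close> is followed by a step in direction \<open>k\<close>. The second step has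
  a shifted base point, and averaging will make this shift invisible.\<close>

lemma diff_quot_insert:
  "k \<notin> A \<Longrightarrow> diff_quot g (insert k A) m x = diff_quot g {k} m (raise A x) + diff_quot g A m x"
  unfolding diff_quot_def by (subst raise_insert) (auto simp: algebra_simps)

context universal_filter
begin

definition slope :: "(c0 \<Rightarrow> real) \<Rightarrow> nat \<Rightarrow> real" where
  "slope g k = Lim F (\<lambda>m. avg m (diff_quot g {k} m))"

lemma slope_tendsto:
  assumes "L-lipschitz_on (sphere 0 1) g"
  shows "((\<lambda>m. avg m (diff_quot g {k} m)) \<longlongrightarrow> slope g k) F"
  unfolding slope_def by (intro tendsto_Lim_bounded[where C = L] avg_bound diff_quot_bound[OF assms])

text \<open>The slopes are additive in the direction because averages are asymptotically invariant under
  shifts.\<close>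

lemma sum_slope_tendsto:
  assumes g: "L-lipschitz_on (sphere 0 1) g" and "finite A" "0 \<notin> A"
  shows "((\<lambda>m. avg m (diff_quot g A m)) \<longlongrightarrow> (\<Sum>k\<in>A. slope g k)) F"
  using assms(2,3)
proof (induction A)
  case empty
  then show ?case by (simp add: diff_quot_def avg_def)
next
  case (insert k A)
  have "((\<lambda>m. avg m (\<lambda>x. diff_quot g {k} m (raise A x)) - avg m (diff_quot g {k} m)) \<longlongrightarrow> 0) F"
    using insert.prems insert.hyps le_sequentially
    by (intro filterlim_mono[OF avg_raise_tendsto[OF _ _ diff_quot_bound[OF g]]]) auto
  from tendsto_add[OF tendsto_add[OF this slope_tendsto[OF g, of k]] insert.IH] insert.prems insert.hyps
  show ?case by (simp add: diff_quot_insert[OF insert.hyps(2)] avg_add)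
qed

lemma sum_slope_bound:
  assumes "L-lipschitz_on (sphere 0 1) g" "finite A" "0 \<notin> A"
  shows "\<bar>\<Sum>k\<in>A. slope g k\<bar> \<le> L"
  using tendsto_upperbound[OF tendsto_rabs[OF sum_slope_tendsto[OF assms]] _ nontrivial]
    avg_bound[OF diff_quot_bound[OF assms(1)]] by (simp add: eventually_mono)

text \<open>A bound on all finite partial sums, over arbitrary sets of directions, bounds the sums of
  absolute values: separate the nonnegative slopes from the negative ones.\<close>

lemma sum_abs_slope_bound:
  assumes g: "L-lipschitz_on (sphere 0 1) g" and A: "finite A" "0 \<notin> A"
  shows "(\<Sum>k\<in>A. \<bar>slope g k\<bar>) \<le> 2 * L"
proof -
  define P where "P = {k \<in> A. slope g k \<ge> 0}"
  have "(\<Sum>k\<in>A. \<bar>slope g k\<bar>) = (\<Sum>k\<in>P. \<bar>slope g k\<bar>) + (\<Sum>k\<in>A - P. \<bar>slope g k\<bar>)"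
    using A by (subst sum.subset_diff[of P]) (auto simp: P_def)
  also have "\<dots> = (\<Sum>k\<in>P. slope g k) - (\<Sum>k\<in>A - P. slope g k)"
    unfolding diff_conv_add_uminus sum_negf[symmetric]
    by (intro arg_cong2[where f = "(+)"] sum.cong) (auto simp: P_def)
  also have "\<dots> \<le> 2 * L"
    using sum_slope_bound[OF g, of P] sum_slope_bound[OF g, of "A - P"] A
    by (auto simp: P_def abs_le_iff)
  finally show ?thesis .
qed

lemma slope_add:
  assumes f: "K-lipschitz_on (sphere 0 1) f" and g: "L-lipschitz_on (sphere 0 1) g"
  shows "slope (\<lambda>u. f u + g u) k = slope f k + slope g k"
proof -
  have eq: "avg m (diff_quot (\<lambda>u. f u + g u) {k} m) = avg m (diff_quot f {k} m) + avg m (diff_quot g {k} m)" for m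
    unfolding avg_add[symmetric] by (rule arg_cong[where f = "avg m"]) (simp add: diff_quot_def fun_eq_iff algebra_simps)
  show ?thesis unfolding slope_def[of "\<lambda>u. f u + g u"] eq
    by (intro tendsto_Lim[OF nontrivial] tendsto_add slope_tendsto[OF f] slope_tendsto[OF g])
qed

lemma slope_cmult:
  assumes g: "L-lipschitz_on (sphere 0 1) g"
  shows "slope (\<lambda>u. c * g u) k = c * slope g k"
proof -
  have eq: "avg m (diff_quot (\<lambda>u. c * g u) {k} m) = c * avg m (diff_quot g {k} m)" for m
    unfolding avg_cmult[symmetric] by (rule arg_cong[where f = "avg m"]) (simp add: diff_quot_def fun_eq_iff algebra_simps)
  show ?thesis unfolding slope_def[of "\<lambda>u. c * g u"] eq
    by (intro tendsto_Lim[OF nontrivial] tendsto_mult_left slope_tendsto[OF g])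
qed

lemma slope_coord:
  assumes g: "\<And>u. u \<in> sphere 0 1 \<Longrightarrow> g u = apply_bcontfun (c0_seq u) j + a" and k: "k \<noteq> 0"
  shows "slope g k = (if k = j then 1 else 0)"
proof -
  have "avg m (diff_quot g {k} m) = (if k = j then 1 else 0)" if "k \<le> m" for m
  proof (rule avg_const)
    fix x assume "x \<in> grid m"
    then have "x k \<le> m" using that k by (auto simp: grid_def PiE_iff)
    then have "real (x k) / real (Suc m) \<le> 1" "real (Suc (x k)) / real (Suc m) \<le> 1"
      by (auto simp: divide_le_eq_1)
    then show "diff_quot g {k} m x = (if k = j then 1 else 0)"
      using that k
      by (auto simp: diff_quot_def g[OF point_in_sphere] coords_def raise_def min_absorb2
          simp del: of_nat_Suc simp flip: right_diff_distrib diff_divide_distrib)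
  qed
  then have "(\<lambda>m. avg m (diff_quot g {k} m)) \<longlonglongrightarrow> (if k = j then 1 else 0)"
    by (intro tendsto_eventually eventually_sequentiallyI[of k])
  then show ?thesis unfolding slope_def by (rule Lim_sequential)
qed

text \<open>The functionals \<open>a \<mapsto> \<Sum>\<^sub>k\<^sub>>\<^sub>n a\<^sub>k\<close> on \<open>\<ell>\<^sub>1\<close>, composed with the
  averaged gradient.\<close>

definition tail :: "nat \<Rightarrow> (c0 \<Rightarrow> real) \<Rightarrow> real" where
  "tail n g = (\<Sum>k. slope g (Suc (k + n)))"

lemma summable_slope:
  assumes g: "L-lipschitz_on (sphere 0 1) g"
  shows "summable (\<lambda>k. \<bar>slope g (Suc (k + n))\<bar>)"
    and "(\<Sum>k. \<bar>slope g (Suc (k + n))\<bar>) \<le> 2 * L"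
proof -
  have bd: "(\<Sum>k<N. \<bar>slope g (Suc (k + n))\<bar>) \<le> 2 * L" for N
  proof -
    have "inj_on (\<lambda>k. Suc (k + n)) {..<N}" by (rule inj_onI) simp
    then show ?thesis
      using sum_abs_slope_bound[OF g, of "(\<lambda>k. Suc (k + n)) ` {..<N}"]
      by (simp add: sum.reindex image_iff)
  qed
  show *: "summable (\<lambda>k. \<bar>slope g (Suc (k + n))\<bar>)"
    by (rule summableI_nonneg_bounded[OF _ bd]) simp
  show "(\<Sum>k. \<bar>slope g (Suc (k + n))\<bar>) \<le> 2 * L"
    by (rule suminf_le_const[OF * bd])
qed

lemma tail_bound:
  assumes "L-lipschitz_on (sphere 0 1) g"
  shows "\<bar>tail n g\<bar> \<le> 2 * L"
  unfolding tail_def using summable_rabs[OF summable_slope(1)[OF assms]] summable_slope(2)[OF assms]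
  by (rule order_trans)

lemma tail_add:
  assumes f: "K-lipschitz_on (sphere 0 1) f" and g: "L-lipschitz_on (sphere 0 1) g"
  shows "tail n (\<lambda>u. f u + g u) = tail n f + tail n g"
  unfolding tail_def slope_add[OF f g]
  by (intro suminf_add[symmetric] summable_rabs_cancel[OF summable_slope(1)[OF f]]
      summable_rabs_cancel[OF summable_slope(1)[OF g]])

lemma tail_cmult:
  assumes g: "L-lipschitz_on (sphere 0 1) g"
  shows "tail n (\<lambda>u. c * g u) = c * tail n g"
  unfolding tail_def slope_cmult[OF g]
  by (intro suminf_mult summable_rabs_cancel[OF summable_slope(1)[OF g]])

lemma tail_tendsto_0:
  assumes g: "L-lipschitz_on (sphere 0 1) g"
  shows "(\<lambda>n. tail n g) \<longlonglongrightarrow> 0"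
proof -
  define s where "s k = slope g (Suc k)" for k
  have s: "summable s"
    using summable_rabs_cancel[OF summable_slope(1)[OF g, of 0]] by (simp add: s_def[abs_def])
  have "tail n g = suminf s - (\<Sum>k<n. s k)" for n
  proof -
    have "tail n g = (\<Sum>k. s (k + n))" by (simp add: tail_def s_def)
    then show ?thesis using suminf_minus_initial_segment[OF s, of n] by simp
  qed
  moreover have "(\<lambda>n. suminf s - (\<Sum>k<n. s k)) \<longlonglongrightarrow> suminf s - suminf s"
    by (intro tendsto_intros summable_LIMSEQ s)
  ultimately show ?thesis by simp
qed

lemma tail_coord:
  assumes g: "\<And>u. u \<in> sphere 0 1 \<Longrightarrow> g u = apply_bcontfun (c0_seq u) j + a" and j: "n < j"
  shows "tail n g = 1"
proof -
  have "slope g (Suc k) = (if Suc k = j then 1 else 0)" for k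
    by (rule slope_coord) (use g in auto)
  then have "(\<lambda>k. slope g (Suc (k + n))) = (\<lambda>k. if k = j - Suc n then 1 else 0)"
    using j by (auto simp: fun_eq_iff)
  then show ?thesis
    using sums_single[of "j - Suc n" "\<lambda>_. 1 :: real"] unfolding tail_def by (simp add: sums_iff)
qed

end

section \<open>Spheres of isomorphic copies\<close>

lemma dist_sgn_le:
  fixes x y :: "'a::real_normed_vector"
  assumes "x \<noteq> 0" "y \<noteq> 0"
  shows "dist (sgn x) (sgn y) \<le> 2 * dist x y / norm x"
proof -
  have "sgn x - sgn y = (x - y) /\<^sub>R norm x + (inverse (norm x) - inverse (norm y)) *\<^sub>R y"
    by (simp add: sgn_div_norm algebra_simps)
  then have "norm (sgn x - sgn y)
      \<le> norm (x - y) / norm x + \<bar>inverse (norm x) - inverse (norm y)\<bar> * norm y"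
    using norm_triangle_ineq[of "(x - y) /\<^sub>R norm x" "(inverse (norm x) - inverse (norm y)) *\<^sub>R y"]
    by (simp add: divide_inverse mult.commute)
  also have "\<bar>inverse (norm x) - inverse (norm y)\<bar> * norm y = \<bar>norm y - norm x\<bar> / norm x"
  proof -
    have "inverse (norm x) - inverse (norm y) = (norm y - norm x) / (norm x * norm y)"
      using assms by (simp add: field_simps)
    then show ?thesis using assms by (simp add: abs_mult)
  qed
  also have "\<dots> \<le> norm (x - y) / norm x"
    using norm_triangle_ineq3[of x y] by (intro divide_right_mono) auto
  finally show ?thesis by (simp add: dist_norm)
qed

text \<open>The map \<open>u \<mapsto> T u / \<parallel>T u\<parallel>\<close> is bilipschitz on the sphere. Its inverse has the same form,
  namely normalisation in \<open>'x\<close> after \<open>T\<inverse>\<close>, so \<open>dist_sgn_le\<close> gives both inequalities.\<close>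

lemma bilipschitz_copy_sphere_isomorphic_copy:
  assumes iso: "contains_isomorphic_copy TYPE('x::real_normed_vector) TYPE('y::real_normed_vector)"
    and copy: "contains_bilipschitz_copy TYPE('m::metric_space) (sphere (0::'y) 1)"
  shows "contains_bilipschitz_copy TYPE('m) (sphere (0::'x) 1)"
proof -
  obtain T :: "'x \<Rightarrow>\<^sub>L 'y" and c where c: "0 < c" and T: "\<And>x. c * norm x \<le> norm (T x)"
    using iso unfolding contains_isomorphic_copy_def by blast
  obtain h :: "'y \<Rightarrow> 'm" and a b where ab: "0 < a" "0 < b"
    and h: "\<And>p q. p \<in> sphere 0 1 \<Longrightarrow> q \<in> sphere 0 1 \<Longrightarrow>
      a * dist p q \<le> dist (h p) (h q) \<and> dist (h p) (h q) \<le> b * dist p q"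
    using copy unfolding contains_bilipschitz_copy_def by blast
  define K where "K = norm T + 1"
  have K: "0 < K" by (simp add: K_def add_nonneg_pos)
  have TK: "norm (T x) \<le> K * norm x" for x
    using norm_blinfun[of T x] by (simp add: K_def algebra_simps add_increasing)
  define R where "R = 2 * K / c"
  have R: "0 < R" using K c by (simp add: R_def)
  define J where "J u = sgn (T u)" for u
  have J_sphere: "J u \<in> sphere 0 1" and Tc: "c \<le> norm (T u)" and T0: "T u \<noteq> 0"
    if "u \<in> sphere 0 1" for u
    using that T[of u] c by (auto simp: J_def norm_sgn)
  have upper: "dist (J u) (J w) \<le> R * dist u w" if "u \<in> sphere 0 1" "w \<in> sphere 0 1" for u w
  proof -
    have "dist (J u) (J w) \<le> 2 * dist (T u) (T w) / norm (T u)"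
      unfolding J_def using that by (intro dist_sgn_le T0)
    also have "\<dots> \<le> 2 * (K * dist u w) / c"
      using TK[of "u - w"] Tc[OF that(1)] c K
      by (intro frac_le mult_left_mono) (auto simp: dist_norm blinfun.diff_right)
    finally show ?thesis by (simp add: R_def mult.assoc)
  qed
  have lower: "dist u w \<le> R * dist (J u) (J w)" if u: "u \<in> sphere 0 1" and w: "w \<in> sphere 0 1" for u w
  proof -
    \<comment> \<open>The preimages of \<open>J u\<close> and \<open>J w\<close> under \<open>T\<close>; normalising them gives back \<open>u\<close> and \<open>w\<close>.\<close>
    define x where "x = u /\<^sub>R norm (T u)"
    define y where "y = w /\<^sub>R norm (T w)"
    have J: "J u = T x" "J w = T y"
      by (simp_all add: J_def x_def y_def sgn_div_norm blinfun.scaleR_right)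
    have "u \<noteq> 0" "w \<noteq> 0" using u w by auto
    with T0[OF u] T0[OF w] have xy: "x \<noteq> 0" "y \<noteq> 0" by (auto simp: x_def y_def)
    have "sgn x = u" "sgn y = w" "norm x = inverse (norm (T u))"
      using u w T0[OF u] T0[OF w] by (simp_all add: x_def y_def sgn_div_norm)
    with dist_sgn_le[OF xy] have "dist u w \<le> 2 * norm (T u) * dist x y"
      by (simp add: divide_inverse mult_ac)
    also have "\<dots> \<le> 2 * K * dist x y"
      using TK[of u] u by (intro mult_right_mono) auto
    also have "\<dots> \<le> 2 * K * (dist (J u) (J w) / c)"
      using T[of "x - y"] c K
      by (intro mult_left_mono) (auto simp: J dist_norm blinfun.diff_right field_simps)
    finally show ?thesis by (simp add: R_def)
  qed
  show ?thesis
    unfolding contains_bilipschitz_copy_def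
  proof (rule exI[of _ "h \<circ> J"], rule exI[of _ "a / R"], rule exI[of _ "b * R"], intro conjI ballI)
    fix u w assume uw: "u \<in> sphere (0::'x) 1" "w \<in> sphere (0::'x) 1"
    note hJ = h[OF J_sphere[OF uw(1)] J_sphere[OF uw(2)]]
    have "a * dist u w \<le> a * (R * dist (J u) (J w))"
      using lower[OF uw] ab by (intro mult_left_mono) auto
    then have "a / R * dist u w \<le> a * dist (J u) (J w)"
      using R by (simp add: field_simps)
    with hJ show "a / R * dist u w \<le> dist ((h \<circ> J) u) ((h \<circ> J) w)" by simp
    have "b * dist (J u) (J w) \<le> b * (R * dist u w)"
      using upper[OF uw] ab by (intro mult_left_mono) auto
    with hJ show "dist ((h \<circ> J) u) ((h \<circ> J) w) \<le> b * R * dist u w" by (simp add: mult.assoc)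
  qed (use ab R in auto)
qed

section \<open>Lipschitz functions on a space containing the unit sphere of c0\<close>

text \<open>McShane's extension, stated for a function given on the domain of a parametrisation \<open>h\<close>. The
  additive constant makes the extension vanish at the base point.\<close>

lemma lip0_extension:
  fixes h :: "'a \<Rightarrow> 'm::pointed_metric_space"
  assumes B: "0 \<le> B" and g: "\<And>u w. u \<in> S \<Longrightarrow> w \<in> S \<Longrightarrow> \<bar>g u - g w\<bar> \<le> B * dist (h u) (h w)"
  shows "\<exists>(f :: 'm lip0) a. norm f \<le> B \<and> (\<forall>u\<in>S. lip0_apply f (h u) = g u + a)"
proof (cases "S = {}")
  case True
  then show ?thesis using B by (intro exI[of _ 0]) auto
next
  case False
  then obtain u0 where u0: "u0 \<in> S" by blast
  \<comment> \<open>The bound makes \<open>g\<close> constant on the fibres of \<open>h\<close>, so it descends to the image.\<close>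
  define g' where "g' p = g (SOME u. u \<in> S \<and> h u = p)" for p
  have g': "g' (h u) = g u" if "u \<in> S" for u
  proof -
    define w where "w = (SOME w. w \<in> S \<and> h w = h u)"
    have "w \<in> S \<and> h w = h u"
      unfolding w_def using someI[of "\<lambda>w. w \<in> S \<and> h w = h u" u] that by simp
    with g[of w u] that have "g w = g u" by simp
    then show ?thesis by (simp add: g'_def w_def)
  qed
  have "\<exists>G. (\<forall>p\<in>h ` S. G p = g' p) \<and>
    (\<forall>x\<in>mspace euclidean_metric. \<forall>y\<in>mspace euclidean_metric. \<bar>G x - G y\<bar> \<le> B * mdist euclidean_metric x y)"
    by (rule mcshane_extension[of _ _ "h u0"]) (use u0 B g in \<open>auto simp: g'\<close>)
  then obtain G where G: "\<And>u. u \<in> S \<Longrightarrow> G (h u) = g u" and GB: "\<And>x y. \<bar>G x - G y\<bar> \<le> B * dist x y"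
    by (auto simp: g')
  define f where "f = Lip0 (\<lambda>x. G x - G base_point)"
  have lip: "B-lipschitz_on UNIV (\<lambda>x. G x - G base_point)"
    using GB B by (auto intro!: lipschitz_onI simp: dist_real_def)
  then have f: "lip0_apply f = (\<lambda>x. G x - G base_point)"
    unfolding f_def by (subst Lip0_inverse) auto
  have "norm f \<le> B" using lip_const_le[OF lip] by (simp add: norm_lip0.rep_eq f)
  moreover have "\<forall>u\<in>S. lip0_apply f (h u) = g u + - G base_point" by (simp add: f G)
  ultimately show ?thesis by blast
qed

lemma weak_limit_imp_weak_star_limit:
  assumes "weak_limit \<phi> \<psi>"
  shows "weak_star_limit \<phi> \<psi>"
  unfolding weak_star_limit_def
proof
  fix x
  have "(\<lambda>n. blinfun_apply (Blinfun (\<lambda>\<eta>. blinfun_apply \<eta> x)) (\<phi> n))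
      \<longlonglongrightarrow> blinfun_apply (Blinfun (\<lambda>\<eta>. blinfun_apply \<eta> x)) \<psi>"
    using assms by (simp add: weak_limit_def)
  then show "(\<lambda>n. blinfun_apply (\<phi> n) x) \<longlonglongrightarrow> blinfun_apply \<psi> x"
    by (simp add: bounded_linear_Blinfun_apply blinfun.bounded_linear_left)
qed

text \<open>The tail functionals \<open>\<phi> n\<close> are weak* null, so their only possible weak limit is \<open>0\<close>. The
  extended coordinate functions \<open>e j\<close> are bounded in norm and \<open>\<phi> n (e j) = 1\<close> for
  \<open>j > n\<close>. Hence the element \<open>\<Phi>\<close> of the bidual that takes the generalised limit along
  \<open>j\<close> of the values at \<open>e j\<close> has the value \<open>1\<close> at every \<open>\<phi> n\<close>.\<close>

lemma not_grothendieck_lip0_if_c0_sphere: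
  assumes "contains_bilipschitz_copy TYPE('m::pointed_metric_space) (sphere (0::c0) 1)"
  shows "\<not> grothendieck_space TYPE('m lip0)"
proof
  assume groth: "grothendieck_space TYPE('m lip0)"
  obtain J :: "c0 \<Rightarrow> 'm" and a b where ab: "0 < a" "0 < b"
    and J: "\<And>u w. u \<in> sphere 0 1 \<Longrightarrow> w \<in> sphere 0 1 \<Longrightarrow>
      a * dist u w \<le> dist (J u) (J w) \<and> dist (J u) (J w) \<le> b * dist u w"
    using assms unfolding contains_bilipschitz_copy_def by blast
  obtain F where "universal_filter F" using ex_universal_filter by blast
  then interpret universal_filter F .

  have lip: "(norm f * b)-lipschitz_on (sphere 0 1) (\<lambda>u. lip0_apply f (J u))" for f
  proof (rule lipschitz_onI)
    fix u w :: c0 assume uw: "u \<in> sphere 0 1" "w \<in> sphere 0 1"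
    have "dist (lip0_apply f (J u)) (lip0_apply f (J w)) \<le> norm f * dist (J u) (J w)"
      by (rule lipschitz_onD[OF lip0_apply_lipschitz]) auto
    also have "\<dots> \<le> norm f * (b * dist u w)" using J[OF uw] by (intro mult_left_mono) auto
    finally show "dist (lip0_apply f (J u)) (lip0_apply f (J w)) \<le> norm f * b * dist u w"
      by (simp add: mult.assoc)
  qed (use ab in simp)
  define \<phi> where "\<phi> n = Blinfun (\<lambda>f :: 'm lip0. tail n (\<lambda>u. lip0_apply f (J u)))" for n
  have \<phi>: "blinfun_apply (\<phi> n) f = tail n (\<lambda>u. lip0_apply f (J u))" for n f
  proof -
    have "bounded_linear (\<lambda>f :: 'm lip0. tail n (\<lambda>u. lip0_apply f (J u)))"
    proof (rule bounded_linear_intro[where K = "2 * b"])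
      show "norm (tail n (\<lambda>u. lip0_apply f (J u))) \<le> norm f * (2 * b)" for f
        using tail_bound[OF lip] by (simp add: mult_ac)
    qed (simp_all add: plus_lip0.rep_eq scaleR_lip0.rep_eq tail_add[OF lip lip] tail_cmult[OF lip])
    then show ?thesis by (simp add: \<phi>_def bounded_linear_Blinfun_apply)
  qed
  have "weak_star_limit \<phi> 0"
    unfolding weak_star_limit_def \<phi> using tail_tendsto_0[OF lip] by simp
  then obtain \<psi> where \<psi>: "weak_limit \<phi> \<psi>"
    using groth unfolding grothendieck_space_def by blast
  have "\<psi> = 0"
  proof (rule blinfun_eqI)
    fix f
    show "blinfun_apply \<psi> f = blinfun_apply 0 f"
      using weak_limit_imp_weak_star_limit[OF \<psi>] \<open>weak_star_limit \<phi> 0\<close>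
      unfolding weak_star_limit_def using LIMSEQ_unique by blast
  qed

  have "\<exists>(f :: 'm lip0) d. norm f \<le> 1 / a \<and>
      (\<forall>u\<in>sphere 0 1. lip0_apply f (J u) = apply_bcontfun (c0_seq u) j + d)" for j
  proof (rule lip0_extension)
    fix u w :: c0 assume "u \<in> sphere 0 1" "w \<in> sphere 0 1"
    then have "dist u w \<le> 1 / a * dist (J u) (J w)" using J ab by (simp add: field_simps)
    with c0_coord_le
    show "\<bar>apply_bcontfun (c0_seq u) j - apply_bcontfun (c0_seq w) j\<bar> \<le> 1 / a * dist (J u) (J w)"
      by (rule order_trans)
  qed (use ab in simp)
  then obtain e :: "nat \<Rightarrow> 'm lip0" and d where e: "\<And>j. norm (e j) \<le> 1 / a"
    "\<And>j u. u \<in> sphere 0 1 \<Longrightarrow> lip0_apply (e j) (J u) = apply_bcontfun (c0_seq u) j + d j"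
    by metis
  have \<phi>_e: "blinfun_apply (\<phi> n) (e j) = 1" if "n < j" for n j
    unfolding \<phi> using e(2) that by (rule tail_coord)

  define \<Phi> where "\<Phi> = Blinfun (\<lambda>\<eta> :: 'm lip0 \<Rightarrow>\<^sub>L real. Lim F (\<lambda>j. blinfun_apply \<eta> (e j)))"
  have \<eta>_e: "\<bar>blinfun_apply \<eta> (e j)\<bar> \<le> norm \<eta> * (1 / a)" for \<eta> j
    using norm_blinfun[of \<eta> "e j"] mult_left_mono[OF e(1)[of j] norm_ge_zero[of \<eta>]] by simp
  note conv = tendsto_Lim_bounded[OF \<eta>_e]
  have \<Phi>: "blinfun_apply \<Phi> \<eta> = Lim F (\<lambda>j. blinfun_apply \<eta> (e j))" for \<eta>
  proof -
    have "bounded_linear (\<lambda>\<eta> :: 'm lip0 \<Rightarrow>\<^sub>L real. Lim F (\<lambda>j. blinfun_apply \<eta> (e j)))"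
    proof (rule bounded_linear_intro[where K = "1 / a"])
      fix \<eta> \<xi> :: "'m lip0 \<Rightarrow>\<^sub>L real" and r :: real
      show "Lim F (\<lambda>j. blinfun_apply (\<eta> + \<xi>) (e j))
          = Lim F (\<lambda>j. blinfun_apply \<eta> (e j)) + Lim F (\<lambda>j. blinfun_apply \<xi> (e j))"
        unfolding blinfun.add_left by (intro tendsto_Lim[OF nontrivial] tendsto_add conv)
      show "Lim F (\<lambda>j. blinfun_apply (r *\<^sub>R \<eta>) (e j)) = r *\<^sub>R Lim F (\<lambda>j. blinfun_apply \<eta> (e j))"
        unfolding blinfun.scaleR_left by (intro tendsto_Lim[OF nontrivial] tendsto_scaleR tendsto_const conv)
      show "norm (Lim F (\<lambda>j. blinfun_apply \<eta> (e j))) \<le> norm \<eta> * (1 / a)"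
        unfolding real_norm_def
        by (rule tendsto_upperbound[OF tendsto_rabs[OF conv] always_eventually nontrivial])
          (rule allI, rule \<eta>_e)
    qed
    then show ?thesis by (simp add: \<Phi>_def bounded_linear_Blinfun_apply)
  qed
  have "blinfun_apply \<Phi> (\<phi> n) = 1" for n
    unfolding \<Phi>
    by (intro Lim_sequential tendsto_eventually eventually_sequentiallyI[of "Suc n"]) (simp add: \<phi>_e)
  moreover have "(\<lambda>n. blinfun_apply \<Phi> (\<phi> n)) \<longlonglongrightarrow> blinfun_apply \<Phi> 0"
    using \<psi> \<open>\<psi> = 0\<close> by (simp add: weak_limit_def)
  ultimately show False by (simp add: LIMSEQ_const_iff blinfun.zero_right)
qed

theorem theorem5p19:
  assumes "separable_space (euclidean :: 'e::banach topology)"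
    and "absolute_lipschitz_retract (euclidean_metric :: 'e metric)"
    and "contains_isomorphic_copy TYPE(c0) TYPE('e)"
    and "contains_bilipschitz_copy TYPE('m::pointed_metric_space) (sphere (0::'e) 1)"
  shows "\<not> grothendieck_space TYPE('m lip0)"
  by (rule not_grothendieck_lip0_if_c0_sphere[OF bilipschitz_copy_sphere_isomorphic_copy[OF assms(3,4)]])

end
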